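(* Let $g$ be a left-invariant pseudo-Riemannian metric on a unimodular Lie group $G$. Then the generalized pseudo-Riemannian Lie group $(G,H=0,\mathcal G_g)$ is generalized Einstein with divergence $\delta=0$ if and only if $g$ is Ricci-flat.
   Context: Let $\mathfrak g$ be the Lie algebra of $G$ and $E=\mathfrak g\oplus\mathfrak g^*$, with scalar product $\langle X+\xi,Y+\eta\rangle=\frac12(\xi(Y)+\eta(X))$ and (for $H=0$) Dorfman bracket $[X+\xi,Y+\eta]_0=[X,Y]-\mathrm{ad}_X^*\eta+\mathrm{ad}_Y^*\xi$, where $\mathrm{ad}_X^*\eta=\eta\circ\mathrm{ad}_X$. $G$ is unimodular if $\mathrm{tr}\,\mathrm{ad}_X=0$ for all $X\in\mathfrak g$. Put $gX=g(X,\cdot)$, $\mathcal G_g(X+\xi,Y+\eta)=\frac12(g(X,Y)+g^{-1}(\xi,\eta))$ and $E_\pm=\{X\pm gX:X\in\mathfrak g\}$. A left-invariant generalized connection is a linear map $D:E\to\mathfrak{so}(E)$, $u\mapsto D_u$. Its torsion is $T(u,v)=D_uv-D_vu-[u,v]_0+(Du)^*v$, where $Du$ is $w\mapsto D_wu$ and $*$ is the adjoint for $\langle\cdot,\cdot\rangle$. $D$ is Levi-Civita if $T=0$ and $D_uE_\pm\subset E_\pm$ for all $u$. Its divergence is $\delta_D(v)=\mathrm{tr}(u\mapsto D_uv)$. Choose a Levi-Civita $D$ with $\delta_D=0$ (one exists), put $R(u,v)w=D_uD_vw-D_vD_uw-D_{[u,v]_0}w$ and, for $u_\pm\in E_\pm$,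 $Ric^+(u_-,u_+)=\mathrm{tr}(E_+\ni w\mapsto R(w,u_-)u_+\in E_+)$, $Ric^-(u_+,u_-)=\mathrm{tr}(E_-\ni w\mapsto R(w,u_+)u_-\in E_-)$; these are known to be independent of the choice of $D$. $(G,H=0,\mathcal G_g)$ is generalized Einstein with divergence $\delta=0$ if $Ric^+=0$ and $Ric^-=0$. *)

theory Defs
  imports "HOL-Analysis.Analysis"
begin

section \<open>Linear algebra\<close>

text \<open>
  The trace of an endomorphism of a finite-dimensional subspace \<open>V\<close>, computed in a basis of \<open>V\<close>;
  by \<open>trace_on_basis\<close> below the choice of the basis does not matter.
\<close>

definition trace_on :: "'v::real_vector set \<Rightarrow> ('v \<Rightarrow> 'v) \<Rightarrow> real" where
  "trace_on V f =
     (let B = (SOME B. independent B \<and> span B = V) in \<Sum>b\<in>B. representation B (f b) b)"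

lemma trace_on_basis_aux:
  fixes f :: "'v::real_vector \<Rightarrow> 'v"
  assumes B: "finite B" "independent B" "span B = V"
    and C: "finite C" "independent C" "span C = V"
    and f: "linear f" "f ` V \<subseteq> V"
  shows "(\<Sum>b\<in>B. representation B (f b) b) = (\<Sum>c\<in>C. representation C (f c) c)"
proof -
  have expand: "(\<Sum>y\<in>Y. representation X (f y) x * representation Y x y) = representation X (f x) x"
    if X: "independent X" "span X = V" and Y: "finite Y" "independent Y" "span Y = V" and x: "x \<in> X"
    for X Y x
  proof -
    have xV: "x \<in> span Y" using X Y x span_base by blast
    have fy: "f y \<in> span X" if "y \<in> Y" for y
      using that f(2) X(2) Y(3) span_base by blast
    have "f x = f (\<Sum>y\<in>Y. representation Y x y *\<^sub>R y)"
      using real_vector.sum_representation_eq[OF Y(2) xV Y(1) subset_refl] by simp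
    also have "\<dots> = (\<Sum>y\<in>Y. representation Y x y *\<^sub>R f y)"
      by (simp add: linear_sum[OF f(1)] linear_scale[OF f(1)])
    finally have "representation X (f x) x
        = representation X (\<Sum>y\<in>Y. representation Y x y *\<^sub>R f y) x" by simp
    also have "\<dots> = (\<Sum>y\<in>Y. representation X (representation Y x y *\<^sub>R f y) x)"
      using fy by (subst real_vector.representation_sum[OF X(1)]) (auto intro: span_scale)
    also have "\<dots> = (\<Sum>y\<in>Y. representation Y x y * representation X (f y) x)"
      using fy by (simp add: real_vector.representation_scale[OF X(1)])
    finally show ?thesis by (simp add: mult.commute)
  qed
  have expand': "(\<Sum>x\<in>X. representation X (f y) x * representation Y x y) = representation Y (f y) y"
    if X: "finite X" "independent X" "span X = V" and Y: "independent Y" "span Y = V" and y: "y \<in> Y"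
    for X Y y
  proof -
    have fy: "f y \<in> span X"
      using y f(2) X(3) Y(2) span_base by blast
    have xs: "x \<in> span Y" if "x \<in> X" for x using that X Y span_base by blast
    have "representation Y (f y) y = representation Y (\<Sum>x\<in>X. representation X (f y) x *\<^sub>R x) y"
      using real_vector.sum_representation_eq[OF X(2) fy X(1) subset_refl] by simp
    also have "\<dots> = (\<Sum>x\<in>X. representation Y (representation X (f y) x *\<^sub>R x) y)"
      using xs by (subst real_vector.representation_sum[OF Y(1)]) (auto intro: span_scale)
    also have "\<dots> = (\<Sum>x\<in>X. representation X (f y) x * representation Y x y)"
      using xs by (simp add: real_vector.representation_scale[OF Y(1)])
    finally show ?thesis by simp
  qed
  have "(\<Sum>b\<in>B. representation B (f b) b)
      = (\<Sum>b\<in>B. \<Sum>c\<in>C. representation B (f c) b * representation C b c)"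
    using expand[OF B(2,3) C] by simp
  also have "\<dots> = (\<Sum>c\<in>C. \<Sum>b\<in>B. representation B (f c) b * representation C b c)"
    by (rule sum.swap)
  also have "\<dots> = (\<Sum>c\<in>C. representation C (f c) c)"
    using expand'[OF B C(2,3)] by simp
  finally show ?thesis .
qed

lemma trace_on_basis:
  fixes f :: "'v::real_vector \<Rightarrow> 'v"
  assumes B: "finite B" "independent B" "span B = V" and f: "linear f" "f ` V \<subseteq> V"
  shows "trace_on V f = (\<Sum>b\<in>B. representation B (f b) b)"
proof -
  define C where "C = (SOME C. independent C \<and> span C = V)"
  have C: "independent C \<and> span C = V"
    unfolding C_def by (rule someI[of _ B]) (use B in simp)
  have "finite C"
    using C B(1,3) real_vector.independent_span_bound[of B C] span_superset by blast
  then have "(\<Sum>c\<in>C. representation C (f c) c) = (\<Sum>b\<in>B. representation B (f b) b)"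
    using C B f trace_on_basis_aux[of C V B f] by blast
  then show ?thesis unfolding trace_on_def Let_def C_def .
qed

text \<open>The algebraic dual of a real vector space.\<close>

typedef (overloaded) 'a dual = "{\<phi> :: 'a::real_vector \<Rightarrow> real. linear \<phi>}"
  morphisms app Dual
  by (rule exI[of _ "\<lambda>_. 0"]) (simp add: linear_zero)

lemma linear_app: "linear (app \<phi>)"
  using app[of \<phi>] by simp

lemma app_Dual: "linear \<phi> \<Longrightarrow> app (Dual \<phi>) = \<phi>"
  by (simp add: Dual_inverse)

lemma dual_eqI: "(\<And>x. app \<phi> x = app \<psi> x) \<Longrightarrow> \<phi> = \<psi>"
  by (simp add: app_inject[symmetric] fun_eq_iff)

instantiation dual :: (real_vector) real_vector
begin

definition "0 = Dual (\<lambda>_. 0)"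
definition "\<phi> + \<psi> = Dual (\<lambda>x. app \<phi> x + app \<psi> x)"
definition "\<phi> - \<psi> = Dual (\<lambda>x. app \<phi> x - app \<psi> x)"
definition "- \<phi> = Dual (\<lambda>x. - app \<phi> x)"
definition "r *\<^sub>R \<phi> = Dual (\<lambda>x. r * app \<phi> x)"

lemma app_simps [simp]:
  shows "app 0 x = 0" "app (\<phi> + \<psi>) x = app \<phi> x + app \<psi> x" "app (\<phi> - \<psi>) x = app \<phi> x - app \<psi> x"
    "app (- \<phi>) x = - app \<phi> x" "app (r *\<^sub>R \<phi>) x = r * app \<phi> x"
  unfolding zero_dual_def plus_dual_def minus_dual_def uminus_dual_def scaleR_dual_def
  by (subst app_Dual; simp add: linear_iff linear_add[OF linear_app] linear_scale[OF linear_app]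
      algebra_simps)+

instance
  by standard (auto intro!: dual_eqI simp: algebra_simps)

end


section \<open>Left-invariant pseudo-Riemannian metrics\<close>

text \<open>
  The type \<open>'a\<close> is the Lie algebra of \<open>G\<close>; left-invariant tensors and connections on \<open>G\<close> are
  given by their values on left-invariant vector fields.
\<close>

definition finite_dimensional :: "'a::real_vector itself \<Rightarrow> bool" where
  "finite_dimensional _ \<longleftrightarrow> (\<exists>B :: 'a set. finite B \<and> span B = UNIV)"

definition lie_bracket :: "('a::real_vector \<Rightarrow> 'a \<Rightarrow> 'a) \<Rightarrow> bool" where
  "lie_bracket br \<longleftrightarrow> bilinear br \<and> (\<forall>X. br X X = 0) \<and>
     (\<forall>X Y Z. br X (br Y Z) + br Y (br Z X) + br Z (br X Y) = 0)"

definition unimodular :: "('a::real_vector \<Rightarrow> 'a \<Rightarrow> 'a) \<Rightarrow> bool" where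
  "unimodular br \<longleftrightarrow> (\<forall>X. trace_on UNIV (br X) = 0)"

definition pseudo_riemannian :: "('a::real_vector \<Rightarrow> 'a \<Rightarrow> real) \<Rightarrow> bool" where
  "pseudo_riemannian g \<longleftrightarrow> bilinear g \<and> (\<forall>X Y. g X Y = g Y X) \<and>
     (\<forall>X. (\<forall>Y. g X Y = 0) \<longrightarrow> X = 0)"

definition levi_civita_connection ::
    "('a::real_vector \<Rightarrow> 'a \<Rightarrow> 'a) \<Rightarrow> ('a \<Rightarrow> 'a \<Rightarrow> real) \<Rightarrow> 'a \<Rightarrow> 'a \<Rightarrow> 'a" where
  "levi_civita_connection br g = (THE N. bilinear N \<and>
     (\<forall>X Y. N X Y - N Y X = br X Y) \<and>
     (\<forall>X Y Z. g (N X Y) Z + g Y (N X Z) = 0))"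

text \<open>
  The curvature \<open>D\<^sub>u D\<^sub>v w - D\<^sub>v D\<^sub>u w - D\<^bsub>[u,v]\<^esub> w\<close> of \<open>D\<close> with respect to a bracket; it is used both on
  the Lie algebra and, with the Dorfman bracket, on \<open>E\<close>.
\<close>

definition curvature ::
    "('v::real_vector \<Rightarrow> 'v \<Rightarrow> 'v) \<Rightarrow> ('v \<Rightarrow> 'v \<Rightarrow> 'v) \<Rightarrow> 'v \<Rightarrow> 'v \<Rightarrow> 'v \<Rightarrow> 'v" where
  "curvature br D u v w = D u (D v w) - D v (D u w) - D (br u v) w"

definition ricci :: "('a::real_vector \<Rightarrow> 'a \<Rightarrow> 'a) \<Rightarrow> ('a \<Rightarrow> 'a \<Rightarrow> real) \<Rightarrow> 'a \<Rightarrow> 'a \<Rightarrow> real" where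
  "ricci br g X Y = trace_on UNIV (\<lambda>Z. curvature br (levi_civita_connection br g) Z X Y)"

definition ricci_flat :: "('a::real_vector \<Rightarrow> 'a \<Rightarrow> 'a) \<Rightarrow> ('a \<Rightarrow> 'a \<Rightarrow> real) \<Rightarrow> bool" where
  "ricci_flat br g \<longleftrightarrow> (\<forall>X Y. ricci br g X Y = 0)"


section \<open>Generalized geometry on \<open>E = \<gg> \<oplus> \<gg>\<^sup>*\<close> with \<open>H = 0\<close>\<close>

type_synonym 'a gen = "'a \<times> 'a dual"

definition pairing :: "'a::real_vector gen \<Rightarrow> 'a gen \<Rightarrow> real" where
  "pairing u v = (app (snd u) (fst v) + app (snd v) (fst u)) / 2"

definition coad :: "('a::real_vector \<Rightarrow> 'a \<Rightarrow> 'a) \<Rightarrow> 'a \<Rightarrow> 'a dual \<Rightarrow> 'a dual" where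
  "coad br X \<eta> = Dual (app \<eta> \<circ> br X)"

definition dorfman :: "('a::real_vector \<Rightarrow> 'a \<Rightarrow> 'a) \<Rightarrow> 'a gen \<Rightarrow> 'a gen \<Rightarrow> 'a gen" where
  "dorfman br u v = (br (fst u) (fst v), - coad br (fst u) (snd v) + coad br (fst v) (snd u))"

definition flat :: "('a::real_vector \<Rightarrow> 'a \<Rightarrow> real) \<Rightarrow> 'a \<Rightarrow> 'a dual" where
  "flat g X = Dual (g X)"

definition E_plus :: "('a::real_vector \<Rightarrow> 'a \<Rightarrow> real) \<Rightarrow> 'a gen set" where
  "E_plus g = {(X, flat g X) | X. True}"

definition E_minus :: "('a::real_vector \<Rightarrow> 'a \<Rightarrow> real) \<Rightarrow> 'a gen set" where
  "E_minus g = {(X, - flat g X) | X. True}"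

text \<open>
  The generalized metric of \<open>g\<close>, where \<open>g\<^sup>-\<^sup>1(\<xi>, \<eta>) = \<xi> (g\<^sup>-\<^sup>1 \<eta>)\<close>. It enters the remaining notions only
  through its eigenbundles \<open>E_plus g\<close> and \<open>E_minus g\<close>; see \<open>E_plus_eigen\<close> and \<open>E_minus_eigen\<close>.
\<close>

definition gen_metric :: "('a::real_vector \<Rightarrow> 'a \<Rightarrow> real) \<Rightarrow> 'a gen \<Rightarrow> 'a gen \<Rightarrow> real" where
  "gen_metric g u v = (g (fst u) (fst v) + app (snd u) (inv (flat g) (snd v))) / 2"

lemma app_flat:
  assumes "pseudo_riemannian g"
  shows "app (flat g X) Y = g X Y"
  using assms unfolding flat_def pseudo_riemannian_def bilinear_def by (simp add: app_Dual)

lemma linear_flat: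
  assumes "pseudo_riemannian g"
  shows "linear (flat g)"
proof -
  have "bilinear g" using assms by (simp add: pseudo_riemannian_def)
  then show ?thesis
    by (auto simp: linear_iff app_flat[OF assms] bilinear_ladd bilinear_lmul intro!: dual_eqI)
qed

lemma bij_flat:
  fixes g :: "'a::real_vector \<Rightarrow> 'a \<Rightarrow> real"
  assumes "finite_dimensional TYPE('a)" "pseudo_riemannian g"
  shows "bij (flat g)"
proof -
  have inj: "inj (flat g)"
  proof (subst linear_injective_0[OF linear_flat[OF assms(2)]], intro allI impI)
    fix X assume "flat g X = 0"
    then have "\<forall>Y. g X Y = 0" using app_flat[OF assms(2)] by (metis app_simps(1))
    then show "X = 0" using assms(2) by (simp add: pseudo_riemannian_def)
  qed
  obtain F :: "'a set" where F: "finite F" "span F = UNIV"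
    using assms(1) unfolding finite_dimensional_def by blast
  obtain B :: "'a set" where B: "B \<subseteq> F" "independent B" "F \<subseteq> span B"
    using real_vector.maximal_independent_subset by blast
  have fB: "finite B" using B(1) F(1) finite_subset by blast
  have sB: "span B = UNIV" using B(3) F(2) real_vector.span_minimal[OF B(3) subspace_span] by auto
  define co where "co b = Dual (\<lambda>x. representation B x b)" for b
  have app_co: "app (co b) x = representation B x b" for b x
    unfolding co_def
    by (subst app_Dual)
       (simp_all add: linear_iff real_vector.representation_add[OF B(2)]
         real_vector.representation_scale[OF B(2)] sB)
  have app_sum: "app (sum f A) x = (\<Sum>a\<in>A. app (f a) x)" for f :: "'a \<Rightarrow> 'a dual" and A x
    by (induction A rule: infinite_finite_induct) auto
  have "\<phi> = (\<Sum>b\<in>B. app \<phi> b *\<^sub>R co b)" for \<phi>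
  proof (rule dual_eqI)
    fix x
    have "app \<phi> x = app \<phi> (\<Sum>b\<in>B. representation B x b *\<^sub>R b)"
      using real_vector.sum_representation_eq[OF B(2) _ fB subset_refl, of x] sB by simp
    also have "\<dots> = (\<Sum>b\<in>B. representation B x b * app \<phi> b)"
      by (simp add: linear_sum[OF linear_app] linear_scale[OF linear_app])
    finally show "app \<phi> x = app (\<Sum>b\<in>B. app \<phi> b *\<^sub>R co b) x"
      by (simp add: app_sum app_co mult.commute)
  qed
  note co = this
  have sco: "\<phi> \<in> span (co ` B)" for \<phi>
    by (subst co[of \<phi>], intro span_sum span_scale span_base imageI)
  have ind: "independent (flat g ` B)"
    by (rule linear_independent_injective_image[OF linear_flat[OF assms(2)] B(2)])
       (rule inj_on_subset[OF inj subset_UNIV])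
  have "\<phi> \<in> span (flat g ` B)" for \<phi>
  proof (rule ccontr)
    assume \<phi>: "\<phi> \<notin> span (flat g ` B)"
    then have "independent (insert \<phi> (flat g ` B))"
      by (rule real_vector.independent_insertI[OF _ ind])
    then have "card (insert \<phi> (flat g ` B)) \<le> card (co ` B)"
      using real_vector.independent_span_bound[OF finite_imageI[OF fB], of _ co] sco
      by (simp add: subset_iff)
    also have "\<dots> \<le> card B"
      by (rule card_image_le[OF fB])
    also have "\<dots> = card (flat g ` B)"
      by (rule card_image[symmetric, OF inj_on_subset[OF inj subset_UNIV]])
    moreover have "\<phi> \<notin> flat g ` B"
      using \<phi> by (rule contrapos_nn) (rule span_base)
    ultimately show False
      using fB by simp
  qed
  then have "\<phi> \<in> flat g ` span B" for \<phi>
    unfolding linear_span_image[OF linear_flat[OF assms(2)]] .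
  then have "surj (flat g)"
    unfolding sB by (simp add: surj_def image_iff)
  then show ?thesis using inj by (simp add: bij_def)
qed

lemma E_plus_eigen:
  fixes g :: "'a::real_vector \<Rightarrow> 'a \<Rightarrow> real"
  assumes "finite_dimensional TYPE('a)" "pseudo_riemannian g"
  shows "E_plus g = {u. \<forall>v. gen_metric g u v = pairing u v}"
proof -
  note b = bij_flat[OF assms]
  have g: "bilinear g" "g X Y = g Y X" for X Y using assms(2) by (simp_all add: pseudo_riemannian_def)
  have "(X, \<xi>) \<in> E_plus g \<longleftrightarrow> (\<forall>v. gen_metric g (X, \<xi>) v = pairing (X, \<xi>) v)" for X \<xi>
  proof
    assume "(X, \<xi>) \<in> E_plus g"
    then have \<xi>: "\<xi> = flat g X" by (auto simp: E_plus_def)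
    show "\<forall>v. gen_metric g (X, \<xi>) v = pairing (X, \<xi>) v"
    proof
      fix v :: "'a gen"
      have "app \<xi> (inv (flat g) (snd v)) = app (flat g (inv (flat g) (snd v))) X"
        by (simp add: \<xi> app_flat[OF assms(2)] g(2))
      also have "\<dots> = app (snd v) X"
        using b by (simp add: bij_is_surj surj_f_inv_f)
      finally show "gen_metric g (X, \<xi>) v = pairing (X, \<xi>) v"
        by (simp add: gen_metric_def pairing_def \<xi> app_flat[OF assms(2)])
    qed
  next
    assume *: "\<forall>v. gen_metric g (X, \<xi>) v = pairing (X, \<xi>) v"
    have "app \<xi> Y = app (flat g X) Y" for Y
    proof -
      have "inv (flat g) 0 = 0"
        using b linear_0[OF linear_flat[OF assms(2)]] by (metis bij_is_inj inv_f_f)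
      then show ?thesis
        using *[rule_format, of "(Y, 0)"]
        by (simp add: gen_metric_def pairing_def app_flat[OF assms(2)] linear_0[OF linear_app])
    qed
    then have "\<xi> = flat g X" by (rule dual_eqI)
    then show "(X, \<xi>) \<in> E_plus g" by (auto simp: E_plus_def)
  qed
  then show ?thesis by auto
qed

lemma E_minus_eigen:
  fixes g :: "'a::real_vector \<Rightarrow> 'a \<Rightarrow> real"
  assumes "finite_dimensional TYPE('a)" "pseudo_riemannian g"
  shows "E_minus g = {u. \<forall>v. gen_metric g u v = - pairing u v}"
proof -
  note b = bij_flat[OF assms]
  have g: "bilinear g" "g X Y = g Y X" for X Y using assms(2) by (simp_all add: pseudo_riemannian_def)
  have "(X, \<xi>) \<in> E_minus g \<longleftrightarrow> (\<forall>v. gen_metric g (X, \<xi>) v = - pairing (X, \<xi>) v)" for X \<xi>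
  proof
    assume "(X, \<xi>) \<in> E_minus g"
    then have \<xi>: "\<xi> = - flat g X" by (auto simp: E_minus_def)
    show "\<forall>v. gen_metric g (X, \<xi>) v = - pairing (X, \<xi>) v"
    proof
      fix v :: "'a gen"
      have "app \<xi> (inv (flat g) (snd v)) = - app (flat g (inv (flat g) (snd v))) X"
        by (simp add: \<xi> app_flat[OF assms(2)] g(2))
      also have "\<dots> = - app (snd v) X"
        using b by (simp add: bij_is_surj surj_f_inv_f)
      finally show "gen_metric g (X, \<xi>) v = - pairing (X, \<xi>) v"
        by (simp add: gen_metric_def pairing_def \<xi> app_flat[OF assms(2)] field_simps)
    qed
  next
    assume *: "\<forall>v. gen_metric g (X, \<xi>) v = - pairing (X, \<xi>) v"
    have "app \<xi> Y = app (- flat g X) Y" for Y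
    proof -
      have "inv (flat g) 0 = 0"
        using b linear_0[OF linear_flat[OF assms(2)]] by (metis bij_is_inj inv_f_f)
      then show ?thesis
        using *[rule_format, of "(Y, 0)"]
        by (simp add: gen_metric_def pairing_def app_flat[OF assms(2)] linear_0[OF linear_app])
    qed
    then have "\<xi> = - flat g X" by (rule dual_eqI)
    then show "(X, \<xi>) \<in> E_minus g" by (auto simp: E_minus_def)
  qed
  then show ?thesis by auto
qed

definition skew_adjoint :: "('a::real_vector gen \<Rightarrow> 'a gen) \<Rightarrow> bool" where
  "skew_adjoint A \<longleftrightarrow> (\<forall>u v. pairing (A u) v + pairing u (A v) = 0)"

definition pairing_adjoint :: "('a::real_vector gen \<Rightarrow> 'a gen) \<Rightarrow> 'a gen \<Rightarrow> 'a gen" where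
  "pairing_adjoint A = (THE A'. \<forall>u v. pairing (A' u) v = pairing u (A v))"

definition gen_connection :: "('a::real_vector gen \<Rightarrow> 'a gen \<Rightarrow> 'a gen) \<Rightarrow> bool" where
  "gen_connection D \<longleftrightarrow> bilinear D \<and> (\<forall>u. skew_adjoint (D u))"

definition gen_torsion :: "('a::real_vector \<Rightarrow> 'a \<Rightarrow> 'a) \<Rightarrow> ('a gen \<Rightarrow> 'a gen \<Rightarrow> 'a gen) \<Rightarrow>
    'a gen \<Rightarrow> 'a gen \<Rightarrow> 'a gen" where
  "gen_torsion br D u v = D u v - D v u - dorfman br u v + pairing_adjoint (\<lambda>w. D w u) v"

definition gen_levi_civita :: "('a::real_vector \<Rightarrow> 'a \<Rightarrow> 'a) \<Rightarrow> ('a \<Rightarrow> 'a \<Rightarrow> real) \<Rightarrow>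
    ('a gen \<Rightarrow> 'a gen \<Rightarrow> 'a gen) \<Rightarrow> bool" where
  "gen_levi_civita br g D \<longleftrightarrow> gen_connection D \<and> (\<forall>u v. gen_torsion br D u v = 0) \<and>
     (\<forall>u. D u ` E_plus g \<subseteq> E_plus g \<and> D u ` E_minus g \<subseteq> E_minus g)"

definition gen_divergence :: "('a::real_vector gen \<Rightarrow> 'a gen \<Rightarrow> 'a gen) \<Rightarrow> 'a gen \<Rightarrow> real" where
  "gen_divergence D v = trace_on UNIV (\<lambda>u. D u v)"

definition ric_plus :: "('a::real_vector \<Rightarrow> 'a \<Rightarrow> 'a) \<Rightarrow> ('a \<Rightarrow> 'a \<Rightarrow> real) \<Rightarrow>
    ('a gen \<Rightarrow> 'a gen \<Rightarrow> 'a gen) \<Rightarrow> 'a gen \<Rightarrow> 'a gen \<Rightarrow> real" where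
  "ric_plus br g D u v = trace_on (E_plus g) (\<lambda>w. curvature (dorfman br) D w u v)"

definition ric_minus :: "('a::real_vector \<Rightarrow> 'a \<Rightarrow> 'a) \<Rightarrow> ('a \<Rightarrow> 'a \<Rightarrow> real) \<Rightarrow>
    ('a gen \<Rightarrow> 'a gen \<Rightarrow> 'a gen) \<Rightarrow> 'a gen \<Rightarrow> 'a gen \<Rightarrow> real" where
  "ric_minus br g D u v = trace_on (E_minus g) (\<lambda>w. curvature (dorfman br) D w u v)"

text \<open>
  On \<open>E_minus g \<times> E_plus g\<close> and \<open>E_plus g \<times> E_minus g\<close> respectively, the tensors \<open>ric_plus\<close> and
  \<open>ric_minus\<close> depend on \<open>D\<close> only through its divergence, so which \<open>D\<close> with divergence \<open>\<delta>\<close> is chosen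
  is immaterial.
\<close>

definition generalized_einstein :: "('a::real_vector \<Rightarrow> 'a \<Rightarrow> 'a) \<Rightarrow> ('a \<Rightarrow> 'a \<Rightarrow> real) \<Rightarrow>
    ('a gen \<Rightarrow> real) \<Rightarrow> bool" where
  "generalized_einstein br g \<delta> \<longleftrightarrow>
     (\<exists>D. gen_levi_civita br g D \<and> gen_divergence D = \<delta> \<and>
        (\<forall>u\<in>E_minus g. \<forall>v\<in>E_plus g. ric_plus br g D u v = 0) \<and>
        (\<forall>u\<in>E_plus g. \<forall>v\<in>E_minus g. ric_minus br g D u v = 0))"

end

theory Submission
  imports Defs
begin

text \<open>
  Torsion-freeness forces every generalized Levi-Civita connection \<open>D\<close> to act on mixed arguments by
  \<open>\<nabla>\<close>: the derivative of \<open>Y \<plusminus> gY\<close> along \<open>X \<minusplus> gX\<close> is \<open>\<nabla>\<^sub>XY \<plusminus> g\<nabla>\<^sub>XY\<close>. If the divergence of \<open>D\<close>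
  vanishes, its pure parts drop out of the generalized Ricci tensors by cyclicity of the trace, and
  both tensors become minus the trace of the map sending \<open>Z\<close> to the derivative of \<open>Y\<close> along \<open>\<nabla>\<^sub>ZX\<close>.
  On a unimodular Lie algebra \<open>\<nabla>\<close> itself is divergence-free, so the Ricci tensor of \<open>g\<close> is given by
  the same expression. Letting \<open>\<nabla>\<close> act on both summands of \<open>E\<close>, through the projection of the
  first argument to \<open>\<gg>\<close>, yields a divergence-free generalized Levi-Civita connection.
\<close>

section \<open>Traces\<close>

lemma finite_dimensional_basis:
  assumes "finite_dimensional TYPE('v::real_vector)"
  obtains B :: "'v::real_vector set" where "finite B" "independent B" "span B = UNIV"
proof -
  obtain F :: "'v set" where F: "finite F" "span F = UNIV"
    using assms unfolding finite_dimensional_def by blast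
  obtain B :: "'v set" where B: "B \<subseteq> F" "independent B" "F \<subseteq> span B"
    using real_vector.maximal_independent_subset by blast
  have "span B = UNIV"
    using B(3) F(2) real_vector.span_minimal[OF B(3) subspace_span] by auto
  then show ?thesis
    using that B F finite_subset by blast
qed

lemma linear_basis_expansion:
  fixes f :: "'v::real_vector \<Rightarrow> 'w::real_vector"
  assumes "linear f" "finite B" "independent B" "span B = UNIV"
  shows "f x = (\<Sum>b\<in>B. representation B x b *\<^sub>R f b)"
proof -
  have "f x = f (\<Sum>b\<in>B. representation B x b *\<^sub>R b)"
    using real_vector.sum_representation_eq[OF assms(3) _ assms(2) subset_refl, of x] assms(4)
    by simp
  then show ?thesis
    by (simp add: linear_sum[OF assms(1)] linear_scale[OF assms(1)])
qed

lemma linear_representation: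
  fixes B :: "'v::real_vector set"
  assumes "independent B" "span B = UNIV"
  shows "linear (\<lambda>x. representation B x b)"
  using assms
  by (simp add: linear_iff real_vector.representation_add real_vector.representation_scale)

lemma trace_on_UNIV_basis:
  fixes f :: "'v::real_vector \<Rightarrow> 'v"
  assumes "finite B" "independent B" "span B = UNIV" "linear f"
  shows "trace_on UNIV f = (\<Sum>b\<in>B. representation B (f b) b)"
  by (rule trace_on_basis) (use assms in auto)

lemma trace_add:
  fixes f h :: "'v::real_vector \<Rightarrow> 'v"
  assumes "finite_dimensional TYPE('v)" "linear f" "linear h"
  shows "trace_on UNIV (\<lambda>x. f x + h x) = trace_on UNIV f + trace_on UNIV h"
proof -
  obtain B :: "'v set" where B: "finite B" "independent B" "span B = UNIV"
    using finite_dimensional_basis[OF assms(1)] .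
  note [simp] = trace_on_UNIV_basis[OF B] linear_add[OF linear_representation[OF B(2,3)]]
  show ?thesis
    by (simp add: assms linear_compose_add sum.distrib)
qed

lemma trace_scale:
  fixes f :: "'v::real_vector \<Rightarrow> 'v"
  assumes "finite_dimensional TYPE('v)" "linear f"
  shows "trace_on UNIV (\<lambda>x. r *\<^sub>R f x) = r * trace_on UNIV f"
proof -
  obtain B :: "'v set" where B: "finite B" "independent B" "span B = UNIV"
    using finite_dimensional_basis[OF assms(1)] .
  note [simp] = trace_on_UNIV_basis[OF B] linear_scale[OF linear_representation[OF B(2,3)]]
  show ?thesis
    by (simp add: assms linear_compose_scale_right sum_distrib_left)
qed

lemma trace_diff:
  fixes f h :: "'v::real_vector \<Rightarrow> 'v"
  assumes "finite_dimensional TYPE('v)" "linear f" "linear h"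
  shows "trace_on UNIV (\<lambda>x. f x - h x) = trace_on UNIV f - trace_on UNIV h"
  using trace_add[OF assms(1,2) linear_compose_scale_right[OF assms(3), of "-1"]]
    trace_scale[OF assms(1,3), of "-1"] by simp

lemma trace_commute:
  fixes f h :: "'v::real_vector \<Rightarrow> 'v"
  assumes "finite_dimensional TYPE('v)" and f: "linear f" and h: "linear h"
  shows "trace_on UNIV (\<lambda>x. f (h x)) = trace_on UNIV (\<lambda>x. h (f x))"
proof -
  obtain B :: "'v set" where B: "finite B" "independent B" "span B = UNIV"
    using finite_dimensional_basis[OF assms(1)] .
  define r where "r = representation B"
  have lin: "linear (\<lambda>x. k (k' x))" if "linear k" "linear k'" for k k' :: "'v \<Rightarrow> 'v"
    using linear_compose[OF that(2,1)] by (simp add: o_def)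
  \<comment> \<open>The matrix product formula for a diagonal entry: the \<open>b\<close>-coordinate
    of \<open>k\<close> is a linear functional, expanded here at \<open>k' b\<close>.\<close>
  have r: "r (k (k' b)) b = (\<Sum>c\<in>B. r (k' b) c * r (k c) b)" if "linear k"
    for k k' :: "'v \<Rightarrow> 'v" and b
    using linear_basis_expansion[OF linear_compose[OF that linear_representation[OF B(2,3), of b]] B,
        of "k' b"]
    by (simp add: r_def o_def)
  have "trace_on UNIV (\<lambda>x. f (h x)) = (\<Sum>b\<in>B. \<Sum>c\<in>B. r (h b) c * r (f c) b)"
    by (simp add: trace_on_UNIV_basis[OF B] lin f h r flip: r_def)
  also have "\<dots> = (\<Sum>c\<in>B. \<Sum>b\<in>B. r (f c) b * r (h b) c)"
    by (subst sum.swap) (simp add: mult.commute)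
  also have "\<dots> = trace_on UNIV (\<lambda>x. h (f x))"
    by (simp add: trace_on_UNIV_basis[OF B] lin f h r flip: r_def)
  finally show ?thesis .
qed

text \<open>An injective linear \<open>e\<close> carries a basis to a basis of its range without
  changing coordinates. Applied to \<open>lift t\<close>, this turns traces over
  \<open>E_plus g\<close> and \<open>E_minus g\<close> into traces over the Lie algebra.\<close>

lemma trace_on_range_conjugate:
  fixes e :: "'v::real_vector \<Rightarrow> 'w::real_vector"
  assumes "finite_dimensional TYPE('v)" and e: "linear e" "inj e"
    and f: "linear f" and h: "linear h" and fe: "\<And>x. f (e x) = e (h x)"
  shows "trace_on (range e) f = trace_on UNIV h"
proof -
  obtain B :: "'v set" where B: "finite B" "independent B" "span B = UNIV"
    using finite_dimensional_basis[OF assms(1)] .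
  have inj: "inj_on e B" using e(2) inj_on_subset by blast
  have ind: "independent (e ` B)"
    by (rule linear_independent_injective_image[OF e(1) B(2)]) (use e(2) B(3) in simp)
  have spn: "span (e ` B) = range e"
    using linear_span_image[OF e(1), of B] B(3) by simp
  have rep: "representation (e ` B) (e x) (e b) = representation B x b" if "b \<in> B" for x b
  proof -
    have bb: "representation (e ` B) (e c) (e b) = (if c = b then 1 else 0)" if "c \<in> B" for c
      using that \<open>b \<in> B\<close> inj
      by (simp add: real_vector.representation_basis[OF ind] inj_on_eq_iff)
    have lin: "linear (\<lambda>x. representation (e ` B) (e x) (e b))"
      by (simp add: linear_iff linear_add[OF e(1)] linear_scale[OF e(1)] spn
          real_vector.representation_add[OF ind] real_vector.representation_scale[OF ind])
    have "representation (e ` B) (e x) (e b)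
        = (\<Sum>c\<in>B. representation B x c * representation (e ` B) (e c) (e b))"
      using linear_basis_expansion[OF lin B, of x] by simp
    also have "\<dots> = representation B x b"
      using \<open>b \<in> B\<close> B(1) by (simp add: bb if_distrib[of "(*) _"] cong: if_cong)
    finally show ?thesis .
  qed
  have "trace_on (range e) f = (\<Sum>c\<in>e ` B. representation (e ` B) (f c) c)"
    by (rule trace_on_basis) (use B(1) ind spn f fe in auto)
  also have "\<dots> = (\<Sum>b\<in>B. representation (e ` B) (e (h b)) (e b))"
    by (simp add: sum.reindex[OF inj] fe)
  also have "\<dots> = trace_on UNIV h"
    by (simp add: rep trace_on_UNIV_basis[OF B h])
  finally show ?thesis .
qed

text \<open>Extend a basis of \<open>V\<close> to the whole space. Since \<open>f\<close> takes
  values in \<open>V\<close>, no added basis vector contributes a diagonal entry.\<close>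

lemma trace_on_UNIV_eq_trace_on_subspace:
  fixes f :: "'v::real_vector \<Rightarrow> 'v"
  assumes "finite_dimensional TYPE('v)" "subspace V" and f: "linear f" "range f \<subseteq> V"
  shows "trace_on UNIV f = trace_on V f"
proof -
  obtain C where C: "C \<subseteq> V" "independent C" "V \<subseteq> span C"
    using real_vector.maximal_independent_subset by blast
  have sC: "span C = V"
    using C assms(2) real_vector.span_minimal by blast
  obtain B where "C \<subseteq> B" "independent B" "UNIV \<subseteq> span B"
    using real_vector.maximal_independent_subset_extend[OF subset_UNIV C(2)] by metis
  then have B: "C \<subseteq> B" "independent B" "span B = UNIV"
    by auto
  obtain F :: "'v set" where F: "finite F" "span F = UNIV"
    using assms(1) unfolding finite_dimensional_def by blast
  have fB: "finite B"
    using real_vector.independent_span_bound[OF F(1) B(2)] F(2) by auto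
  have "trace_on UNIV f = (\<Sum>b\<in>B. representation B (f b) b)"
    by (rule trace_on_UNIV_basis[OF fB B(2,3) f(1)])
  also have "\<dots> = (\<Sum>b\<in>B. representation C (f b) b)"
    using f(2) sC by (subst real_vector.representation_extend[OF B(2) _ B(1)]) auto
  also have "\<dots> = (\<Sum>b\<in>C. representation C (f b) b)"
    by (rule sum.mono_neutral_right[OF fB B(1)])
       (use real_vector.representation_ne_zero in blast)
  also have "\<dots> = trace_on V f"
    by (rule trace_on_basis[symmetric]) (use finite_subset[OF B(1) fB] C(2) sC f in auto)
  finally show ?thesis .
qed


section \<open>The Levi-Civita connection of a left-invariant metric\<close>

locale metric_lie_algebra =
  fixes br :: "'a::real_vector \<Rightarrow> 'a \<Rightarrow> 'a" and g :: "'a \<Rightarrow> 'a \<Rightarrow> real"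
  assumes fin: "finite_dimensional TYPE('a)"
    and lie: "lie_bracket br"
    and metric: "pseudo_riemannian g"
begin

abbreviation nabla :: "'a \<Rightarrow> 'a \<Rightarrow> 'a" ("\<nabla>") where
  "\<nabla> \<equiv> levi_civita_connection br g"

lemma bilinear_g: "bilinear g" and g_sym: "g X Y = g Y X"
  and nondegenerate: "(\<And>Z. g X Z = 0) \<Longrightarrow> X = 0"
  using metric by (auto simp: pseudo_riemannian_def)

lemmas g_simps [simp] =
  bilinear_ladd[OF bilinear_g] bilinear_radd[OF bilinear_g]
  bilinear_lsub[OF bilinear_g] bilinear_rsub[OF bilinear_g]
  bilinear_lneg[OF bilinear_g] bilinear_rneg[OF bilinear_g]
  bilinear_lmul[OF bilinear_g] bilinear_rmul[OF bilinear_g]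
  bilinear_lzero[OF bilinear_g] bilinear_rzero[OF bilinear_g]

lemma g_eqI:
  assumes "\<And>Z. g X Z = g Y Z"
  shows "X = Y"
  using nondegenerate[of "X - Y"] assms by simp

lemma bilinear_br: "bilinear br"
  using lie by (simp add: lie_bracket_def)

lemmas br_simps [simp] =
  bilinear_ladd[OF bilinear_br] bilinear_radd[OF bilinear_br]
  bilinear_lmul[OF bilinear_br] bilinear_rmul[OF bilinear_br]

lemma br_anti: "br X Y = - br Y X"
proof -
  have "br (X + Y) (X + Y) = 0" "br X X = 0" "br Y Y = 0"
    using lie unfolding lie_bracket_def by blast+
  then show ?thesis by (simp add: eq_neg_iff_add_eq_0 add.commute)
qed

text \<open>In finite dimension \<open>flat g\<close> is bijective. This is how formulas for scalar
  products are turned into vectors below.\<close>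

lemma riesz:
  assumes "linear \<phi>"
  shows "\<exists>X. \<forall>Y. g X Y = \<phi> Y"
proof -
  obtain X where "flat g X = Dual \<phi>"
    using bij_is_surj[OF bij_flat[OF fin metric]] by (metis surjD)
  then have "g X Y = \<phi> Y" for Y
    using app_flat[OF metric, of X Y] app_Dual[OF assms] by simp
  then show ?thesis by blast
qed

text \<open>The Koszul formula: replace each bracket by its torsion-free expression and cancel with
  the three cyclic instances of compatibility. It determines \<open>N\<close> because
  \<open>g\<close> is nondegenerate.\<close>

lemma koszul_unique:
  assumes torsion_free: "\<And>X Y. N X Y - N Y X = br X Y"
    and compatible: "\<And>X Y Z. g (N X Y) Z + g Y (N X Z) = 0"
  shows "2 * g (N X Y) Z = g (br X Y) Z - g (br Y Z) X + g (br Z X) Y"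
  unfolding torsion_free[symmetric]
  using compatible[of X Y Z] compatible[of Y Z X] compatible[of Z X Y]
  by (simp add: g_sym)

lemma nabla_props: "bilinear \<nabla> \<and> (\<forall>X Y. \<nabla> X Y - \<nabla> Y X = br X Y) \<and>
   (\<forall>X Y Z. g (\<nabla> X Y) Z + g Y (\<nabla> X Z) = 0)"
proof -
  \<comment> \<open>For existence, the Koszul formula is read as a definition: its right-hand side
    is linear in \<open>Z\<close>, hence represented by a vector.\<close>
  have "\<exists>W. \<forall>Z. g W Z = (g (br X Y) Z - g (br Y Z) X + g (br Z X) Y) / 2" for X Y
    by (rule riesz) (simp add: linear_iff algebra_simps add_divide_distrib diff_divide_distrib)
  then obtain N where N: "g (N X Y) Z = (g (br X Y) Z - g (br Y Z) X + g (br Z X) Y) / 2" for X Y Z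
    by metis
  have lin1: "linear (N X)" for X
    by (auto simp: linear_iff N algebra_simps add_divide_distrib diff_divide_distrib intro!: g_eqI)
  have lin2: "linear (\<lambda>X. N X Y)" for Y
    by (auto simp: linear_iff N algebra_simps add_divide_distrib diff_divide_distrib intro!: g_eqI)
  have tf: "N X Y - N Y X = br X Y" for X Y
  proof (rule g_eqI)
    fix Z
    show "g (N X Y - N Y X) Z = g (br X Y) Z"
      using br_anti[of Y X] br_anti[of Z X] br_anti[of Z Y] by (simp add: N field_simps)
  qed
  have comp: "g (N X Y) Z + g Y (N X Z) = 0" for X Y Z
  proof -
    have "g Y (N X Z) = g (N X Z) Y" by (rule g_sym)
    then show ?thesis
      using br_anti[of Y X] br_anti[of Z X] br_anti[of Z Y] by (simp add: N field_simps)
  qed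
  have "\<exists>!N. bilinear N \<and> (\<forall>X Y. N X Y - N Y X = br X Y) \<and>
     (\<forall>X Y Z. g (N X Y) Z + g Y (N X Z) = 0)"
  proof (rule ex1I[of _ N], goal_cases)
    case 1
    show ?case using lin1 lin2 tf comp by (auto simp: bilinear_def)
  next
    case (2 M)
    have "M X Y = N X Y" for X Y
    proof (rule g_eqI)
      fix Z
      show "g (M X Y) Z = g (N X Y) Z"
        using koszul_unique[of M X Y Z] koszul_unique[of N X Y Z] 2 tf comp by simp
    qed
    then show ?case by blast
  qed
  from theI'[OF this] show ?thesis
    unfolding levi_civita_connection_def .
qed

lemma bilinear_nabla: "bilinear \<nabla>"
  and br_eq: "br X Y = \<nabla> X Y - \<nabla> Y X"
  and nabla_compatible: "g (\<nabla> X Y) Z = - g Y (\<nabla> X Z)"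
  using nabla_props by (auto simp: eq_neg_iff_add_eq_0)

lemma linear_nabla: "linear (\<nabla> X)" "linear (\<lambda>X. \<nabla> X Y)"
  using bilinear_nabla by (auto simp: bilinear_def)

lemmas nabla_simps [simp] =
  bilinear_ladd[OF bilinear_nabla] bilinear_radd[OF bilinear_nabla]
  bilinear_lsub[OF bilinear_nabla] bilinear_rsub[OF bilinear_nabla]
  bilinear_lmul[OF bilinear_nabla] bilinear_rmul[OF bilinear_nabla]

section \<open>Divergence of the Levi-Civita connection and the Ricci tensor\<close>

lemma trace_skew:
  assumes A: "linear A" and skew: "\<And>X Y. g (A X) Y = - g X (A Y)"
  shows "trace_on UNIV A = 0"
proof -
  obtain B :: "'a set" where B: "finite B" "independent B" "span B = UNIV"
    using finite_dimensional_basis[OF fin] .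
  have "\<exists>d. \<forall>X. g d X = representation B X b" for b
    by (rule riesz) (rule linear_representation[OF B(2,3)])
  \<comment> \<open>\<open>d\<close> is the \<open>g\<close>-dual basis of \<open>B\<close>. By the
    symmetry of \<open>g\<close>, the trace of \<open>A\<close> can be computed with
    \<open>d\<close> and \<open>B\<close> interchanged; skewness says that the interchange reverses
    the sign.\<close>
  then obtain d where d: "g (d b) X = representation B X b" for b X
    by metis
  have expand: "\<phi> X = (\<Sum>b\<in>B. g (d b) X * \<phi> b)" if "linear \<phi>" for \<phi> :: "'a \<Rightarrow> real" and X
    using linear_basis_expansion[OF that B, of X] by (simp add: d)
  have lin: "linear (\<lambda>X. g c (A X))" "linear (\<lambda>c. g c (A X))" for c X
    by (simp_all add: linear_iff linear_add[OF A] linear_scale[OF A])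
  have tr: "trace_on UNIV A = (\<Sum>b\<in>B. g (d b) (A b))"
    by (simp add: trace_on_UNIV_basis[OF B A] d)
  \<comment> \<open>First \<open>d c\<close> is expanded in \<open>B\<close> inside
    \<open>A\<close>; after the swap, the sum over \<open>c\<close> is the expansion of
    \<open>d b\<close> in the other slot.\<close>
  have "(\<Sum>c\<in>B. g c (A (d c))) = (\<Sum>c\<in>B. \<Sum>b\<in>B. g (d b) (d c) * g c (A b))"
    by (rule sum.cong[OF refl]) (rule expand[OF lin(1)])
  also have "\<dots> = (\<Sum>b\<in>B. \<Sum>c\<in>B. g (d c) (d b) * g c (A b))"
    by (subst sum.swap) (simp add: g_sym)
  also have "\<dots> = (\<Sum>b\<in>B. g (d b) (A b))"
    by (intro sum.cong[OF refl] expand[OF lin(2), symmetric])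
  finally have "trace_on UNIV A = (\<Sum>c\<in>B. g (A (d c)) c)"
    by (simp add: tr g_sym)
  then show ?thesis
    by (simp add: skew tr sum_negf)
qed

text \<open>By torsion-freeness the operator is \<open>\<nabla> Y - br Y\<close>: the first term is
  skew for \<open>g\<close>, the second is traceless by unimodularity. Every use of unimodularity
  goes through this lemma.\<close>

lemma trace_nabla:
  assumes "unimodular br"
  shows "trace_on UNIV (\<lambda>X. \<nabla> X Y) = 0"
proof -
  have "(\<lambda>X. \<nabla> X Y) = (\<lambda>X. \<nabla> Y X - br Y X)"
    by (simp add: br_eq)
  moreover have "trace_on UNIV (\<lambda>X. \<nabla> Y X - br Y X) = trace_on UNIV (\<nabla> Y) - trace_on UNIV (br Y)"
    using bilinear_br by (intro trace_diff fin linear_nabla) (simp add: bilinear_def)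
  ultimately show ?thesis
    using assms trace_skew[OF linear_nabla(1) nabla_compatible] by (simp add: unimodular_def)
qed

text \<open>
  The curvatures defining the Ricci tensor of \<open>g\<close> and its generalized counterparts all have this
  shape; the two middle terms cancel under the trace because \<open>tr (ST) = tr (TS)\<close>.
\<close>

lemma trace_curvature_form:
  assumes A: "bilinear A" and div: "\<And>Y. trace_on UNIV (\<lambda>Z. A Z Y) = 0"
  shows "trace_on UNIV (\<lambda>Z. A Z (\<nabla> X Y) - \<nabla> X (A Z Y) + A (\<nabla> X Z) Y - \<nabla> (\<nabla> Z X) Y)
    = - trace_on UNIV (\<lambda>Z. \<nabla> (\<nabla> Z X) Y)"
proof -
  note [simp] = bilinear_ladd[OF A] bilinear_lmul[OF A]
  have A1: "linear (\<lambda>Z. A Z Y)" for Y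
    using A by (simp add: bilinear_def)
  have lin: "linear (\<lambda>Z. A Z (\<nabla> X Y))" "linear (\<lambda>Z. \<nabla> X (A Z Y))" "linear (\<lambda>Z. A (\<nabla> X Z) Y)"
    "linear (\<lambda>Z. \<nabla> (\<nabla> Z X) Y)"
    by (simp_all add: linear_iff)
  have "trace_on UNIV (\<lambda>Z. \<nabla> X (A Z Y)) = trace_on UNIV (\<lambda>Z. A (\<nabla> X Z) Y)"
    by (rule trace_commute[OF fin linear_nabla(1) A1])
  then show ?thesis
    by (simp add: trace_diff[OF fin] trace_add[OF fin] lin linear_compose_add linear_compose_sub div)
qed

lemma ricci_eq:
  assumes "unimodular br"
  shows "ricci br g X Y = - trace_on UNIV (\<lambda>Z. \<nabla> (\<nabla> Z X) Y)"
proof -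
  have "curvature br \<nabla> Z X Y
      = \<nabla> Z (\<nabla> X Y) - \<nabla> X (\<nabla> Z Y) + \<nabla> (\<nabla> X Z) Y - \<nabla> (\<nabla> Z X) Y" for Z
    by (simp add: curvature_def br_eq[of Z X])
  then show ?thesis
    unfolding ricci_def
    using trace_curvature_form[OF bilinear_nabla trace_nabla[OF assms]] by simp
qed


section \<open>Generalized Levi-Civita connections\<close>

text \<open>The parameter \<open>t\<close> is a sign: the values 1 and -1 parametrize
  \<open>E_plus g\<close> and \<open>E_minus g\<close>, so that both eigenbundles are handled by one
  argument.\<close>

definition lift :: "real \<Rightarrow> 'a \<Rightarrow> 'a gen" where
  "lift t X = (X, t *\<^sub>R flat g X)"

definition sharp :: "'a dual \<Rightarrow> 'a" where
  "sharp = inv (flat g)"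

lemma E_plus_lift: "E_plus g = range (lift 1)"
  and E_minus_lift: "E_minus g = range (lift (-1))"
  by (auto simp: E_plus_def E_minus_def lift_def)

lemma flat_sharp [simp]: "flat g (sharp \<xi>) = \<xi>"
  unfolding sharp_def using bij_flat[OF fin metric] by (simp add: bij_is_surj surj_f_inv_f)

lemma sharp_flat [simp]: "sharp (flat g X) = X"
  unfolding sharp_def using bij_flat[OF fin metric] by (simp add: bij_is_inj)

lemma app_eq_sharp: "app \<xi> X = g (sharp \<xi>) X"
  using app_flat[OF metric, of "sharp \<xi>" X] by simp

lemma linear_sharp: "linear sharp"
  by (auto simp: linear_iff intro!: g_eqI simp flip: app_eq_sharp)

lemmas sharp_simps [simp] = linear_add[OF linear_sharp] linear_scale[OF linear_sharp]
  linear_diff[OF linear_sharp] linear_neg[OF linear_sharp] linear_0[OF linear_sharp]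

lemmas flat_simps [simp] = linear_add[OF linear_flat[OF metric]] linear_scale[OF linear_flat[OF metric]]
  linear_diff[OF linear_flat[OF metric]] linear_neg[OF linear_flat[OF metric]]

lemma pairing_sharp:
  fixes u v :: "'a gen"
  shows "pairing u v = (g (sharp (snd u)) (fst v) + g (sharp (snd v)) (fst u)) / 2"
  by (simp add: pairing_def app_eq_sharp)

lemma pairing_commute: "pairing u v = pairing v u"
  by (simp add: pairing_def add.commute)

lemma pairing_simps [simp]:
  fixes u v w :: "'a gen"
  shows
  "pairing (u + v) w = pairing u w + pairing v w"
  "pairing (u - v) w = pairing u w - pairing v w"
  "pairing (r *\<^sub>R u) w = r * pairing u w"
  "pairing 0 w = 0"
  by (simp_all add: pairing_sharp add_divide_distrib diff_divide_distrib algebra_simps)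

lemma pairing_simps_right [simp]:
  fixes u v w :: "'a gen"
  shows
  "pairing w (u + v) = pairing w u + pairing w v"
  "pairing w (r *\<^sub>R u) = r * pairing w u"
  by (simp_all add: pairing_commute[of w])

lemma pairing_nondegenerate:
  fixes u :: "'a gen"
  assumes "\<And>w. pairing u w = 0"
  shows "u = 0"
proof -
  have "sharp (snd u) = 0"
    using assms[of "(_, 0)"] by (intro nondegenerate) (simp add: pairing_sharp)
  then have "flat g (sharp (snd u)) = flat g 0" by simp
  then have "snd u = 0"
    using linear_0[OF linear_flat[OF metric]] by simp
  moreover have "fst u = 0"
    using assms[of "(0, flat g _)"] by (intro nondegenerate) (simp add: pairing_sharp g_sym)
  ultimately show ?thesis by (simp add: prod_eq_iff)
qed

lemma pairing_adjoint:
  fixes A :: "'a gen \<Rightarrow> 'a gen"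
  assumes A: "linear A"
  shows "pairing (pairing_adjoint A u) v = pairing u (A v)"
proof -
  note [simp] = linear_add[OF A] linear_scale[OF A]
  have "\<exists>a. \<forall>v. pairing a v = pairing u (A v)" for u
  proof -
    \<comment> \<open>Testing against vectors and covectors separately yields the covector part
      \<open>flat g P\<close> and the vector part \<open>Q\<close> of the adjoint; the factor 2
      compensates the half in \<open>pairing\<close>.\<close>
    have "linear (\<lambda>X. 2 * pairing u (A (X, 0)))"
      using linear_add[OF A, of "(_, 0)" "(_, 0)"] linear_scale[OF A, of _ "(_, 0)"]
      by (simp add: linear_iff algebra_simps)
    then obtain P where P: "g P X = 2 * pairing u (A (X, 0))" for X
      using riesz by blast
    have "linear (\<lambda>X. 2 * pairing u (A (0, flat g X)))"
      using linear_add[OF A, of "(0, _)" "(0, _)"] linear_scale[OF A, of _ "(0, _)"]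
      by (simp add: linear_iff algebra_simps)
    then obtain Q where Q: "g Q X = 2 * pairing u (A (0, flat g X))" for X
      using riesz by blast
    have "pairing (Q, flat g P) v = pairing u (A v)" for v
    proof -
      have "pairing (Q, flat g P) v
          = pairing u (A (fst v, 0)) + pairing u (A (0, flat g (sharp (snd v))))"
        by (simp add: pairing_sharp[of "(Q, flat g P)"] P g_sym[of _ Q] Q del: flat_sharp)
      also have "\<dots> = pairing u (A ((fst v, 0) + (0, snd v)))"
        by (simp del: add_Pair)
      finally show ?thesis by simp
    qed
    then show ?thesis by blast
  qed
  then obtain A' where A': "pairing (A' u) v = pairing u (A v)" for u v
    by metis
  have "\<forall>u v. pairing (pairing_adjoint A u) v = pairing u (A v)"
    unfolding pairing_adjoint_def
  proof (rule theI[of _ A'])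
    show "\<forall>u v. pairing (A' u) v = pairing u (A v)"
      using A' by blast
    fix A'' assume A'': "\<forall>u v. pairing (A'' u) v = pairing u (A v)"
    have "A'' u - A' u = 0" for u
      by (intro pairing_nondegenerate) (simp add: A' A''[rule_format])
    then show "A'' = A'" by (simp add: fun_eq_iff del: split_paired_All)
  qed
  then show ?thesis by blast
qed

text \<open>Pairing with \<open>w\<close> moves the adjoint onto \<open>w\<close>, so that the
  torsion can be evaluated without knowing the adjoint explicitly.\<close>

lemma pairing_torsion:
  fixes D :: "'a gen \<Rightarrow> 'a gen \<Rightarrow> 'a gen"
  assumes "gen_connection D"
  shows "pairing (gen_torsion br D u v) w = pairing (D u v) w - pairing (D v u) w
    - pairing (dorfman br u v) w + pairing v (D w u)"
proof -
  have "linear (\<lambda>w. D w u)"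
    using assms unfolding gen_connection_def bilinear_def by blast
  then show ?thesis
    by (simp add: gen_torsion_def pairing_adjoint)
qed

lemma linear_lift: "linear (lift t)"
  by (auto simp: linear_iff lift_def algebra_simps)

lemma inj_lift: "inj (lift t)"
  by (auto simp: inj_def lift_def)

text \<open>For opposite signs the factor is 0, so the two eigenbundles are orthogonal; for equal
  signs the pairing is \<open>g\<close> up to the sign \<open>t\<close>.\<close>

lemma pairing_lift: "pairing (lift s X) (lift t Y) = (s + t) / 2 * g X Y"
  by (simp add: pairing_sharp lift_def g_sym[of Y X] algebra_simps add_divide_distrib)

lemma lift_decomposition:
  "u = lift 1 ((1/2) *\<^sub>R (fst u + sharp (snd u))) + lift (-1) ((1/2) *\<^sub>R (fst u - sharp (snd u)))"
  by (cases u) (simp add: lift_def algebra_simps flip: scaleR_add_left)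

lemma fst_lift: "fst (lift t X) = X"
  by (simp add: lift_def)

lemma finite_dimensional_gen: "finite_dimensional TYPE('a gen)"
proof -
  obtain B :: "'a set" where B: "finite B" "independent B" "span B = UNIV"
    using finite_dimensional_basis[OF fin] .
  define S where "S = lift 1 ` B \<union> lift (-1) ` B"
  have "lift t X \<in> span (lift t ` B)" for t X
    using linear_span_image[OF linear_lift, of t B] B(3) by simp
  then have "lift 1 X \<in> span S" "lift (-1) X \<in> span S" for X
    unfolding S_def using real_vector.span_mono by (metis Un_upper1 Un_upper2 subsetD)+
  then have "u \<in> span S" for u
    by (subst lift_decomposition) (intro span_add)
  then show ?thesis
    using B(1) unfolding finite_dimensional_def S_def
    by (intro exI[of _ "lift 1 ` B \<union> lift (-1) ` B"]) auto
qed

section \<open>The Dorfman bracket\<close>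

lemma app_coad: "app (coad br X \<xi>) Y = app \<xi> (br X Y)"
  unfolding coad_def
  by (subst app_Dual) (simp_all add: linear_iff linear_add[OF linear_app] linear_scale[OF linear_app])

lemma bilinear_dorfman: "bilinear (dorfman br)"
  unfolding bilinear_def
  by (auto simp: linear_iff dorfman_def app_coad linear_add[OF linear_app]
      linear_scale[OF linear_app] algebra_simps intro!: dual_eqI)

lemma pairing_dorfman:
  "pairing (dorfman br u v) w = (g (sharp (snd w)) (br (fst u) (fst v))
     - g (sharp (snd v)) (br (fst u) (fst w)) + g (sharp (snd u)) (br (fst v) (fst w))) / 2"
  unfolding pairing_def dorfman_def by (simp add: app_coad) (simp add: app_eq_sharp)

text \<open>The vector part is torsion-freeness of \<nabla> and the covector part is its
  compatibility with \<open>g\<close>. The two summands are the components in the two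
  eigenbundles.\<close>

lemma dorfman_lift_opposite:
  "dorfman br (lift (-t) X) (lift t Y) = lift t (\<nabla> X Y) - lift (-t) (\<nabla> Y X)"
proof (rule prod_eqI)
  show "fst (dorfman br (lift (- t) X) (lift t Y)) = fst (lift t (\<nabla> X Y) - lift (- t) (\<nabla> Y X))"
    by (simp add: dorfman_def lift_def br_eq)
  have "app (- coad br X (t *\<^sub>R flat g Y) + coad br Y (- t *\<^sub>R flat g X)) Z
      = app (t *\<^sub>R flat g (\<nabla> X Y) + t *\<^sub>R flat g (\<nabla> Y X)) Z" for Z
  proof -
    \<comment> \<open>After expanding the brackets, the two terms that differentiate along
      \<open>Z\<close> cancel, because \<open>\<nabla> Z\<close> is skew.\<close>
    have "g Y (br X Z) + g X (br Y Z) = - g (\<nabla> X Y) Z - g (\<nabla> Y X) Z"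
      using g_sym[of Y "\<nabla> Z X"] by (simp add: br_eq nabla_compatible)
    then have "t * (g Y (br X Z) + g X (br Y Z)) = t * (- g (\<nabla> X Y) Z - g (\<nabla> Y X) Z)"
      by (rule arg_cong)
    then show ?thesis
      by (simp add: app_coad app_flat[OF metric] distrib_left right_diff_distrib)
  qed
  then show "snd (dorfman br (lift (- t) X) (lift t Y)) = snd (lift t (\<nabla> X Y) - lift (- t) (\<nabla> Y X))"
    by (auto simp: dorfman_def lift_def intro!: dual_eqI)
qed

section \<open>Generalized Levi-Civita connections on mixed arguments and their Ricci
  tensors\<close>

lemma levi_civita_preserves:
  assumes "gen_levi_civita br g D" "t = 1 \<or> t = -1"
  shows "\<exists>P. D u (lift t Y) = lift t P"
  using assms unfolding gen_levi_civita_def E_plus_lift E_minus_lift by blast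

lemma levi_civita_mixed:
  assumes D: "gen_levi_civita br g D" and t: "t = 1 \<or> t = -1"
  shows "D (lift (-t) X) (lift t Y) = lift t (\<nabla> X Y)"
proof -
  have conn: "gen_connection D" and tf: "gen_torsion br D u v = 0" for u v
    using D unfolding gen_levi_civita_def by blast+
  have t': "-t = 1 \<or> -t = -1" using t by auto
  obtain P where P: "D (lift (-t) X) (lift t Y) = lift t P"
    using levi_civita_preserves[OF D t] by blast
  obtain Q where Q: "D (lift t Y) (lift (-t) X) = lift (-t) Q"
    using levi_civita_preserves[OF D t'] by blast
  have "g P Z = g (\<nabla> X Y) Z" for Z
  proof -
    obtain S where S: "D (lift t Z) (lift (-t) X) = lift (-t) S"
      using levi_civita_preserves[OF D t'] by blast
    \<comment> \<open>Pair the vanishing torsion with \<open>lift t Z\<close>. The terms in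
      \<open>Q\<close> and \<open>S\<close> lie in the opposite eigenbundle and drop out by
      orthogonality, as does one half of the bracket; only \<open>P\<close> and
      \<open>\<nabla> X Y\<close> remain.\<close>
    show ?thesis
      using pairing_torsion[OF conn, of "lift (-t) X" "lift t Y" "lift t Z"] t
      by (auto simp: tf P Q S dorfman_lift_opposite pairing_lift)
  qed
  then show ?thesis
    using P g_eqI by metis
qed

text \<open>For computing divergences: the trace runs over all of E, but an image inside one
  eigenbundle reduces it to a trace over the Lie algebra.\<close>

lemma trace_gen_lift:
  assumes f: "linear f" "range f \<subseteq> range (lift t)" and h: "linear h"
    and fh: "\<And>X. f (lift t X) = lift t (h X)"
  shows "trace_on UNIV f = trace_on UNIV h"
proof -
  have "subspace (range (lift t))"
    using linear_subspace_image[OF linear_lift subspace_UNIV] .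
  then have "trace_on UNIV f = trace_on (range (lift t)) f"
    by (rule trace_on_UNIV_eq_trace_on_subspace[OF finite_dimensional_gen _ f])
  also have "\<dots> = trace_on UNIV h"
    using fin linear_lift inj_lift f(1) h fh by (rule trace_on_range_conjugate)
  finally show ?thesis .
qed

lemma linear_curvature:
  assumes "bilinear b" "bilinear D"
  shows "linear (\<lambda>w. curvature b D w u v)"
  using assms
  by (simp add: linear_iff curvature_def bilinear_ladd bilinear_radd bilinear_lmul bilinear_rmul
      algebra_simps)

lemma generalized_ricci_eq:
  assumes D: "gen_levi_civita br g D" and div: "gen_divergence D = (\<lambda>_. 0)"
    and t: "t = 1 \<or> t = -1"
  shows "trace_on (range (lift t)) (\<lambda>w. curvature (dorfman br) D w (lift (-t) X) (lift t Y))
    = - trace_on UNIV (\<lambda>Z. \<nabla> (\<nabla> Z X) Y)"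
proof -
  have bil: "bilinear D"
    using D by (simp add: gen_levi_civita_def gen_connection_def)
  note [simp] = linear_add[OF linear_lift] linear_scale[OF linear_lift]
    bilinear_ladd[OF bil] bilinear_radd[OF bil] bilinear_lmul[OF bil] bilinear_rmul[OF bil]
  have t': "-t = 1 \<or> -t = -1" using t by auto
  \<comment> \<open>\<open>A\<close> is the pure part of \<open>D\<close> on the eigenbundle of sign
    \<open>t\<close>, read on the Lie algebra.\<close>
  define A where "A Z Y = fst (D (lift t Z) (lift t Y))" for Z Y
  have DA: "D (lift t Z) (lift t Y) = lift t (A Z Y)" for Z Y
    using levi_civita_preserves[OF D t, of "lift t Z" Y] by (auto simp: A_def lift_def)
  have A: "bilinear A"
    by (simp add: bilinear_def linear_iff A_def)
  \<comment> \<open>\<open>D\<close> preserves the eigenbundle, so derivatives along the opposite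
    one contribute nothing to the trace, and vanishing divergence of \<open>D\<close> passes to
    \<open>A\<close>.\<close>
  have "trace_on UNIV (\<lambda>Z. A Z Y) = trace_on UNIV (\<lambda>u. D u (lift t Y))" for Y
  proof (rule trace_gen_lift[symmetric, where t = t])
    show "linear (\<lambda>u. D u (lift t Y))" "linear (\<lambda>Z. A Z Y)"
      using bil A unfolding bilinear_def by blast+
    show "range (\<lambda>u. D u (lift t Y)) \<subseteq> range (lift t)"
      using levi_civita_preserves[OF D t] by blast
  qed (rule DA)
  then have divA: "trace_on UNIV (\<lambda>Z. A Z Y) = 0" for Y
    using div unfolding gen_divergence_def by metis
  define h where "h Z = A Z (\<nabla> X Y) - \<nabla> X (A Z Y) + A (\<nabla> X Z) Y - \<nabla> (\<nabla> Z X) Y" for Z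
  have dorf: "dorfman br (lift t Z) (lift (-t) X) = lift (-t) (\<nabla> Z X) - lift t (\<nabla> X Z)" for Z
    using dorfman_lift_opposite[of "-t" Z X] by simp
  \<comment> \<open>The bracket splits by sign: its component along \<open>lift (-t)\<close>
    differentiates by \<nabla>, its component along \<open>lift t\<close> by \<open>A\<close>. This
    gives the shape required by \<open>trace_curvature_form\<close>.\<close>
  have "curvature (dorfman br) D (lift t Z) (lift (-t) X) (lift t Y) = lift t (h Z)" for Z
    by (simp add: curvature_def h_def dorf DA levi_civita_mixed[OF D t] bilinear_lsub[OF bil]
        linear_diff[OF linear_lift])
  moreover have "linear h"
    by (simp add: linear_iff h_def bilinear_ladd[OF A] bilinear_radd[OF A] bilinear_lmul[OF A]
        bilinear_rmul[OF A] algebra_simps)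
  ultimately have "trace_on (range (lift t)) (\<lambda>w. curvature (dorfman br) D w (lift (-t) X) (lift t Y))
      = trace_on UNIV h"
    by (intro trace_on_range_conjugate[OF fin linear_lift inj_lift] linear_curvature
        bilinear_dorfman bil)
  then show ?thesis
    using trace_curvature_form[OF A divA] by (simp add: h_def[abs_def])
qed

lemma generalized_ricci_tensors:
  assumes "gen_levi_civita br g D" "gen_divergence D = (\<lambda>_. 0)" "unimodular br"
  shows "ric_plus br g D (lift (-1) X) (lift 1 Y) = ricci br g X Y"
    and "ric_minus br g D (lift 1 X) (lift (-1) Y) = ricci br g X Y"
  using generalized_ricci_eq[OF assms(1,2), of 1 X Y] generalized_ricci_eq[OF assms(1,2), of "-1" X Y]
  by (simp_all add: ric_plus_def ric_minus_def E_plus_lift E_minus_lift ricci_eq[OF assms(3)])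

section \<open>A divergence-free generalized Levi-Civita connection\<close>

definition lifted_nabla :: "'a gen \<Rightarrow> 'a gen \<Rightarrow> 'a gen" where
  "lifted_nabla u v = (\<nabla> (fst u) (fst v), flat g (\<nabla> (fst u) (sharp (snd v))))"

lemma bilinear_lifted_nabla: "bilinear lifted_nabla"
  by (simp add: bilinear_def linear_iff lifted_nabla_def)

text \<open>Transporting \<nabla> to covectors by \<open>flat g\<close> makes it commute with
  \<open>lift t\<close>, whence both eigenbundles are preserved. By metric compatibility it is the
  usual dual connection.\<close>

lemma lifted_nabla_lift: "lifted_nabla u (lift t Y) = lift t (\<nabla> (fst u) Y)"
  by (simp add: lifted_nabla_def lift_def)

lemma gen_connection_lifted_nabla: "gen_connection lifted_nabla"
  unfolding gen_connection_def skew_adjoint_def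
proof (intro conjI allI bilinear_lifted_nabla)
  fix u v w
  show "pairing (lifted_nabla u v) w + pairing v (lifted_nabla u w) = 0"
    by (simp add: pairing_sharp lifted_nabla_def nabla_compatible field_simps)
qed

lemma levi_civita_lifted_nabla: "gen_levi_civita br g lifted_nabla"
  unfolding gen_levi_civita_def
proof (intro conjI allI)
  show "gen_connection lifted_nabla" by (rule gen_connection_lifted_nabla)
  fix u v
  show "gen_torsion br lifted_nabla u v = 0"
  proof (rule pairing_nondegenerate)
    fix w
    show "pairing (gen_torsion br lifted_nabla u v) w = 0"
      \<comment> \<open>Expressed through \<nabla> and \<open>g\<close>, the bracket terms cancel
        against the connection terms by torsion-freeness and compatibility of \<nabla>.\<close>
      unfolding pairing_torsion[OF gen_connection_lifted_nabla]
      unfolding pairing_dorfman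
      by (simp add: pairing_sharp lifted_nabla_def br_eq nabla_compatible field_simps)
  qed
next
  fix u
  show "lifted_nabla u ` E_plus g \<subseteq> E_plus g" "lifted_nabla u ` E_minus g \<subseteq> E_minus g"
    by (auto simp: E_plus_lift E_minus_lift lifted_nabla_lift)
qed

lemma divergence_lifted_nabla:
  assumes "unimodular br"
  shows "gen_divergence lifted_nabla = (\<lambda>_. 0)"
proof
  fix v
  have lin: "linear (\<lambda>u. lifted_nabla u v)" for v
    using bilinear_lifted_nabla unfolding bilinear_def by blast
  \<comment> \<open>On one eigenbundle the divergence is that of \<nabla>;
    \<open>lift_decomposition\<close> then covers every \<open>v\<close>.\<close>
  have "trace_on UNIV (\<lambda>u. lifted_nabla u (lift t Y)) = trace_on UNIV (\<lambda>X. \<nabla> X Y)" for t Y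
    by (rule trace_gen_lift[where t = t, OF lin])
       (auto simp: lifted_nabla_lift linear_nabla fst_lift)
  then have "trace_on UNIV (\<lambda>u. lifted_nabla u (lift s X + lift t Y)) = 0" for s t X Y
    by (simp add: bilinear_radd[OF bilinear_lifted_nabla] trace_add[OF finite_dimensional_gen lin lin]
        trace_nabla[OF assms])
  then show "gen_divergence lifted_nabla v = 0"
    unfolding gen_divergence_def by (metis lift_decomposition)
qed

end


theorem corollary2p31:
  fixes br :: "'a::real_vector \<Rightarrow> 'a \<Rightarrow> 'a" and g :: "'a \<Rightarrow> 'a \<Rightarrow> real"
  assumes "finite_dimensional TYPE('a)" and "lie_bracket br" and "unimodular br"
    and "pseudo_riemannian g"
  shows "generalized_einstein br g (\<lambda>_. 0) \<longleftrightarrow> ricci_flat br g"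
proof -
  interpret metric_lie_algebra br g
    by standard (use assms in auto)
  show ?thesis
  proof
    assume "generalized_einstein br g (\<lambda>_. 0)"
    then obtain D where "gen_levi_civita br g D" "gen_divergence D = (\<lambda>_. 0)"
      and "\<forall>u\<in>E_minus g. \<forall>v\<in>E_plus g. ric_plus br g D u v = 0"
      unfolding generalized_einstein_def by blast
    then show "ricci_flat br g"
      using generalized_ricci_tensors(1)[OF _ _ assms(3)]
      by (auto simp: ricci_flat_def E_plus_lift E_minus_lift)
  next
    assume "ricci_flat br g"
    then show "generalized_einstein br g (\<lambda>_. 0)"
      unfolding generalized_einstein_def
      \<comment> \<open>The definition is existential in \<open>D\<close>; the Ricci tensors of this
        witness reduce to that of \<open>g\<close>.\<close>
      by (intro exI[of _ lifted_nabla])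
         (auto simp: levi_civita_lifted_nabla divergence_lifted_nabla[OF assms(3)] E_plus_lift
           E_minus_lift generalized_ricci_tensors[OF levi_civita_lifted_nabla _ assms(3)] ricci_flat_def)
  qed
qed

end
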